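(* The inclusion $c_{0}(\widehat{F})\subset c(\widehat{F})$ holds and is strict, i.e. $c_{0}(\widehat{F})\subseteq c(\widehat{F})$ and $c_{0}(\widehat{F})\neq c(\widehat{F})$.
   Context: Let $\mathbb{N}=\{0,1,2,\dots\}$ and let $\omega$ be the vector space of all real sequences $x=(x_k)_{k\in\mathbb{N}}$. The Fibonacci numbers are defined by $f_0=f_1=1$ and $f_n=f_{n-1}+f_{n-2}$ for $n\ge 2$. For $x\in\omega$ the $\widehat{F}$-transform $\widehat{F}x=(\widehat{F}_n(x))_{n\in\mathbb{N}}$ is defined by $\widehat{F}_0(x)=x_0$ and $\widehat{F}_n(x)=\frac{f_n}{f_{n+1}}x_n-\frac{f_{n+1}}{f_n}x_{n-1}$ for $n\ge1$. Let $c_0$ and $c$ be the spaces of null and of convergent sequences, and put $c_0(\widehat{F})=\{x\in\omega:\widehat{F}x\in c_0\}$ and $c(\widehat{F})=\{x\in\omega:\widehat{F}x\in c\}$. *)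

theory Defs
  imports "HOL-Analysis.Analysis" "HOL-Number_Theory.Fib"
begin

text \<open>The library sequence is indexed by \<open>fib 0 = 0\<close>, \<open>fib 1 = 1\<close>; the convention here is
  \<open>f\<^sub>0 = f\<^sub>1 = 1\<close>, whence the shift.\<close>

definition fibo :: "nat \<Rightarrow> nat"
  where "fibo n = fib (Suc n)"

lemma fibo_0: "fibo 0 = 1"
  and fibo_1: "fibo 1 = 1"
  and fibo_rec: "n \<ge> 2 \<Longrightarrow> fibo n = fibo (n - 1) + fibo (n - 2)"
proof -
  show "fibo 0 = 1" "fibo 1 = 1"
    by (simp_all add: fibo_def)
  show "fibo n = fibo (n - 1) + fibo (n - 2)" if "n \<ge> 2"
  proof -
    from that obtain m where "n = Suc (Suc m)"
      by (metis add_2_eq_Suc le_Suc_ex)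
    then show ?thesis
      by (simp add: fibo_def)
  qed
qed

definition Fhat :: "(nat \<Rightarrow> real) \<Rightarrow> nat \<Rightarrow> real"
  where "Fhat x n =
    (if n = 0 then x 0
     else real (fibo n) / real (fibo (n + 1)) * x n
        - real (fibo (n + 1)) / real (fibo n) * x (n - 1))"

definition c0_seqs :: "(nat \<Rightarrow> real) set"
  where "c0_seqs = {x. x \<longlonglongrightarrow> 0}"

definition c_seqs :: "(nat \<Rightarrow> real) set"
  where "c_seqs = {x. convergent x}"

definition c0_Fhat :: "(nat \<Rightarrow> real) set"
  where "c0_Fhat = {x. Fhat x \<in> c0_seqs}"

definition c_Fhat :: "(nat \<Rightarrow> real) set"
  where "c_Fhat = {x. Fhat x \<in> c_seqs}"

end

theory Submission
  imports Defs
begin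

text \<open>The inclusion holds because null sequences converge. It is strict because the
  transform is given by a lower triangular matrix whose diagonal entries
  \<open>f\<^sub>n / f\<^sub>n\<^sub>+\<^sub>1\<close> are nonzero: forward substitution solves \<open>Fhat x = y\<close> for every \<open>y\<close>,
  and a solution for the constant sequence \<open>y = 1\<close> has a transform
  that converges, but not to zero.\<close>

primrec Fhat_preimage :: "(nat \<Rightarrow> real) \<Rightarrow> nat \<Rightarrow> real"
  where
    "Fhat_preimage y 0 = y 0"
  | "Fhat_preimage y (Suc n) =
      real (fibo (n + 2)) / real (fibo (n + 1))
        * (y (Suc n) + real (fibo (n + 2)) / real (fibo (n + 1)) * Fhat_preimage y n)"

lemma fibo_pos: "fibo n > 0"
  by (simp add: fibo_def fib_neq_0_nat)

lemma Fhat_Fhat_preimage: "Fhat (Fhat_preimage y) = y"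
proof
  fix n
  show "Fhat (Fhat_preimage y) n = y n"
  proof (cases n)
    case 0
    then show ?thesis
      by (simp add: Fhat_def)
  next
    case (Suc m)
    have "real (fibo (Suc m)) \<noteq> 0" "real (fibo (Suc (Suc m))) \<noteq> 0"
      using fibo_pos by (simp_all add: neq0_conv)
    then show ?thesis
      by (simp add: Suc Fhat_def)
  qed
qed

theorem theorem3p4:
  shows "c0_Fhat \<subseteq> c_Fhat \<and> c0_Fhat \<noteq> c_Fhat"
proof
  show "c0_Fhat \<subseteq> c_Fhat"
    by (auto simp: c0_Fhat_def c_Fhat_def c0_seqs_def c_seqs_def convergent_def)
next
  define x where "x = Fhat_preimage (\<lambda>n. 1)"
  have x: "Fhat x = (\<lambda>n. 1)"
    by (simp add: x_def Fhat_Fhat_preimage)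
  then have "x \<in> c_Fhat" "x \<notin> c0_Fhat"
    by (simp_all add: c_Fhat_def c_seqs_def convergent_const c0_Fhat_def c0_seqs_def LIMSEQ_const_iff)
  then show "c0_Fhat \<noteq> c_Fhat"
    by blast
qed

end
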